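(* Let $\delta\in\{1,i\}$ and consider the PDE $$w_{xx}-\delta^2 w_{yy}=Q(w),$$ where $Q$ is a smooth function. This equation admits a functional separation solution if $Q(w)$ has one of the following forms, where $c,c_1,c_2$ are real constants: 1. $Q(w)=c_1w+c_2$; 2. $Q(w)=c_1e^{2w}+c_2e^{-w}$; 3. $Q(w)=c_1e^{2cw}+c_2e^{-cw}$; 4. $Q(w)=c_1w+c_2w\log(w)$; 5. $Q(w)=c_1\sinh(2w)+c_2\left(2\cosh(w)+\sinh(2w)\arctan(\sinh(w))\right)$; 6. $Q(w)=c_1\sin(2w)+\frac{c_2}{4}\left(\sin(2w)\,\mathrm{arctanh}(\sin(w))-2\cos(w)\right)$; 7. $Q(w)=c_1\sin(2w)+c_2\left(2\sin(w)+\sin(2w)\log\left(\tan\left(\frac{w}{2}\right)\right)\right)$; 8. $Q(w)=c_1\sinh(2w)+c_2\left(2\sinh(w)+\sinh(2w)\log\left(\tanh\left(\frac{w}{2}\right)\right)\right)$.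
   Context: Here $w=w(x,y)$ is the unknown function of two real variables and $i$ is the imaginary unit, so that $\delta^2=1$ (hyperbolic case) or $\delta^2=-1$ (elliptic case). A solution $w(x,y)$ is called functional separation if there exists an invertible, smooth function $f$ such that $f(w(x,y))=A(x)+B(y)$ for some function $A$ of $x$ only and some function $B$ of $y$ only; or, equivalently (as the paper puts it), the PDE is compatible with $w_{xy}=F(w)w_xw_y$, where $F(w)=-f''(w)/f'(w)$. Compatibility is meant in the usual sense for overdetermined systems: the mixed derivatives $w_{xxxy}$ and $w_{xxyx}$ computed from the two equations agree identically. *)

theory Defs
  imports "HOL-Analysis.Analysis"
begin

section \<open>Smooth functions of one and of two real variables\<close>

text \<open>Only used on open sets.\<close>

definition smooth_on :: "real set \<Rightarrow> (real \<Rightarrow> real) \<Rightarrow> bool" where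
  "smooth_on S f \<longleftrightarrow> (\<forall>n. (deriv ^^ n) f differentiable_on S)"

definition dx :: "(real \<times> real \<Rightarrow> real) \<Rightarrow> real \<times> real \<Rightarrow> real" where
  "dx w = (\<lambda>(x, y). deriv (\<lambda>s. w (s, y)) x)"

definition dy :: "(real \<times> real \<Rightarrow> real) \<Rightarrow> real \<times> real \<Rightarrow> real" where
  "dy w = (\<lambda>(x, y). deriv (\<lambda>s. w (x, s)) y)"

inductive_set iterated_partials :: "(real \<times> real \<Rightarrow> real) \<Rightarrow> (real \<times> real \<Rightarrow> real) set"
  for w where
  "w \<in> iterated_partials w"
| "v \<in> iterated_partials w \<Longrightarrow> dx v \<in> iterated_partials w"
| "v \<in> iterated_partials w \<Longrightarrow> dy v \<in> iterated_partials w"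

text \<open>On an open set, a function is \<open>C\<^sup>\<infinity>\<close> iff all its iterated partial derivatives
  are (totally) differentiable.\<close>

definition smooth2_on :: "(real \<times> real) set \<Rightarrow> (real \<times> real \<Rightarrow> real) \<Rightarrow> bool" where
  "smooth2_on U w \<longleftrightarrow> (\<forall>v \<in> iterated_partials w. v differentiable_on U)"


section \<open>The PDE and functionally separated solutions\<close>

text \<open>For \<open>\<delta> \<in> {1, \<i>}\<close> the number \<open>\<delta>\<^sup>2\<close> is real, so \<open>Re (\<delta>\<^sup>2)\<close> is just \<open>\<delta>\<^sup>2\<close>
  read as a real number.\<close>

definition pde_solution ::
  "complex \<Rightarrow> (real \<Rightarrow> real) \<Rightarrow> real set \<Rightarrow> (real \<times> real) set \<Rightarrow> (real \<times> real \<Rightarrow> real) \<Rightarrow> bool" where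
  "pde_solution \<delta> Q I U w \<longleftrightarrow>
     smooth2_on U w \<and> w ` U \<subseteq> I \<and>
     (\<forall>z\<in>U. dx (dx w) z - Re (\<delta>\<^sup>2) * dy (dy w) z = Q (w z))"

definition separated_by :: "(real \<Rightarrow> real) \<Rightarrow> (real \<times> real) set \<Rightarrow> (real \<times> real \<Rightarrow> real) \<Rightarrow> bool" where
  "separated_by f U w \<longleftrightarrow> (\<exists>A B. \<forall>(x, y)\<in>U. f (w (x, y)) = A x + B y)"

text \<open>The derivative must not vanish, so that the inverse is smooth as well and
  \<open>- f'' / f'\<close> makes sense.\<close>

definition smooth_invertible_on :: "real set \<Rightarrow> (real \<Rightarrow> real) \<Rightarrow> bool" where
  "smooth_invertible_on I f \<longleftrightarrow> smooth_on I f \<and> inj_on f I \<and> (\<forall>u\<in>I. deriv f u \<noteq> 0)"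

definition sep_coeff :: "(real \<Rightarrow> real) \<Rightarrow> real \<Rightarrow> real" where
  "sep_coeff f u = - deriv (deriv f) u / deriv f u"


section \<open>Compatibility of the PDE with the separation condition\<close>

text \<open>
  The overdetermined system
    \<open>w\<^sub>x\<^sub>x - \<delta>\<^sup>2 w\<^sub>y\<^sub>y = Q(w)\<close>, \<open>w\<^sub>x\<^sub>y = F(w) w\<^sub>x w\<^sub>y\<close>
  leaves \<open>u = w\<close>, \<open>p = w\<^sub>x\<close>, \<open>q = w\<^sub>y\<close>, \<open>r = w\<^sub>x\<^sub>x\<close> free and determines every other derivative as
  a function of \<open>(u, p, q, r)\<close>. The \<open>jet_...\<close> functions below are these expressions.

  The total derivative of \<open>\<phi>(u, p, q)\<close> or \<open>\<phi>(u, p, q, r)\<close> is the chain rule; the trailing arguments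
  are the derivatives of the jet coordinates in the direction considered.
\<close>

definition total_deriv1 ::
  "(real \<Rightarrow> real \<Rightarrow> real \<Rightarrow> real) \<Rightarrow> real \<Rightarrow> real \<Rightarrow> real \<Rightarrow> real \<Rightarrow> real \<Rightarrow> real \<Rightarrow> real" where
  "total_deriv1 \<phi> u p q u' p' q' =
     deriv (\<lambda>s. \<phi> s p q) u * u' + deriv (\<lambda>s. \<phi> u s q) p * p' + deriv (\<lambda>s. \<phi> u p s) q * q'"

definition total_deriv2 ::
  "(real \<Rightarrow> real \<Rightarrow> real \<Rightarrow> real \<Rightarrow> real) \<Rightarrow>
     real \<Rightarrow> real \<Rightarrow> real \<Rightarrow> real \<Rightarrow> real \<Rightarrow> real \<Rightarrow> real \<Rightarrow> real \<Rightarrow> real" where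
  "total_deriv2 \<phi> u p q r u' p' q' r' =
     deriv (\<lambda>s. \<phi> s p q r) u * u' + deriv (\<lambda>s. \<phi> u s q r) p * p' +
     deriv (\<lambda>s. \<phi> u p s r) q * q' + deriv (\<lambda>s. \<phi> u p q s) r * r'"

definition jet_xy :: "(real \<Rightarrow> real) \<Rightarrow> real \<Rightarrow> real \<Rightarrow> real \<Rightarrow> real" where
  "jet_xy F u p q = F u * p * q"

definition jet_yy :: "complex \<Rightarrow> (real \<Rightarrow> real) \<Rightarrow> real \<Rightarrow> real \<Rightarrow> real" where
  "jet_yy \<delta> Q u r = (r - Q u) / Re (\<delta>\<^sup>2)"

text \<open>\<open>w\<^sub>x\<^sub>x\<^sub>y\<close> and \<open>w\<^sub>x\<^sub>y\<^sub>y\<close>: differentiate the second equation with respect to \<open>x\<close> and \<open>y\<close>.\<close>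

definition jet_xxy :: "(real \<Rightarrow> real) \<Rightarrow> real \<Rightarrow> real \<Rightarrow> real \<Rightarrow> real \<Rightarrow> real" where
  "jet_xxy F u p q r = total_deriv1 (jet_xy F) u p q p r (jet_xy F u p q)"

definition jet_xyy ::
  "complex \<Rightarrow> (real \<Rightarrow> real) \<Rightarrow> (real \<Rightarrow> real) \<Rightarrow> real \<Rightarrow> real \<Rightarrow> real \<Rightarrow> real \<Rightarrow> real" where
  "jet_xyy \<delta> Q F u p q r = total_deriv1 (jet_xy F) u p q q (jet_xy F u p q) (jet_yy \<delta> Q u r)"

text \<open>\<open>w\<^sub>x\<^sub>x\<^sub>x\<close>: differentiate the PDE with respect to \<open>x\<close>, i.e.
  \<open>w\<^sub>x\<^sub>x\<^sub>x = \<delta>\<^sup>2 w\<^sub>x\<^sub>y\<^sub>y + Q'(w) w\<^sub>x\<close>.\<close>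

definition jet_xxx ::
  "complex \<Rightarrow> (real \<Rightarrow> real) \<Rightarrow> (real \<Rightarrow> real) \<Rightarrow> real \<Rightarrow> real \<Rightarrow> real \<Rightarrow> real \<Rightarrow> real" where
  "jet_xxx \<delta> Q F u p q r = Re (\<delta>\<^sup>2) * jet_xyy \<delta> Q F u p q r + deriv Q u * p"

definition jet_xxxy ::
  "complex \<Rightarrow> (real \<Rightarrow> real) \<Rightarrow> (real \<Rightarrow> real) \<Rightarrow> real \<Rightarrow> real \<Rightarrow> real \<Rightarrow> real \<Rightarrow> real" where
  "jet_xxxy \<delta> Q F u p q r =
     total_deriv2 (jet_xxx \<delta> Q F) u p q r q (jet_xy F u p q) (jet_yy \<delta> Q u r) (jet_xxy F u p q r)"

definition jet_xxyx ::
  "complex \<Rightarrow> (real \<Rightarrow> real) \<Rightarrow> (real \<Rightarrow> real) \<Rightarrow> real \<Rightarrow> real \<Rightarrow> real \<Rightarrow> real \<Rightarrow> real" where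
  "jet_xxyx \<delta> Q F u p q r =
     total_deriv2 (jet_xxy F) u p q r p r (jet_xy F u p q) (jet_xxx \<delta> Q F u p q r)"

definition compatible :: "complex \<Rightarrow> (real \<Rightarrow> real) \<Rightarrow> (real \<Rightarrow> real) \<Rightarrow> real set \<Rightarrow> bool" where
  "compatible \<delta> Q F I \<longleftrightarrow>
     (\<forall>u\<in>I. \<forall>p q r. jet_xxxy \<delta> Q F u p q r = jet_xxyx \<delta> Q F u p q r)"


section \<open>Admitting a functional separation solution\<close>

text \<open>
  Both descriptions of functional separation are required, with the same \<open>f\<close>: compatibility with
  \<open>w\<^sub>x\<^sub>y = F(w) w\<^sub>x w\<^sub>y\<close>, \<open>F = - f'' / f'\<close>, and existence of a solution with \<open>f(w) = A(x) + B(y)\<close>.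
  The solution has to depend genuinely on both variables: solutions depending on \<open>x\<close> alone
  (or \<open>y\<close> alone) are separated by any \<open>f\<close> and exist for every smooth \<open>Q\<close>.
\<close>

definition admits_functional_separation :: "complex \<Rightarrow> (real \<Rightarrow> real) \<Rightarrow> real set \<Rightarrow> bool" where
  "admits_functional_separation \<delta> Q I \<longleftrightarrow>
     (\<exists>f. smooth_invertible_on I f \<and>
          compatible \<delta> Q (sep_coeff f) I \<and>
          (\<exists>U w. open U \<and> connected U \<and> U \<noteq> {} \<and>
                 pde_solution \<delta> Q I U w \<and> separated_by f U w \<and>
                 (\<forall>z\<in>U. dx w z \<noteq> 0 \<and> dy w z \<noteq> 0)))"

end

theory Submission
  imports Defs
begin

text \<open>
  Write \<open>F = \<phi>' / \<phi>\<close>, i.e. \<open>f' = 1 / \<phi>\<close>. Compatibility amounts to \<open>\<phi>'' = k \<phi>\<close> with a constant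
  \<open>k = F' + F\<^sup>2\<close>, together with the linear equation \<open>Q'' = F Q' + (3 k - F\<^sup>2) Q\<close>, and each of
  the listed \<open>Q\<close> satisfies it for a suitable \<open>\<phi>\<close>.

  To solve the PDE, let \<open>g\<close> be the inverse of \<open>f\<close>, so \<open>g' = \<phi>(g)\<close>, and look for \<open>w = g(A(x) + B(y))\<close>
  with \<open>A'\<^sup>2 = a(A)\<close> and \<open>B'\<^sup>2 = b(B)\<close>. With \<open>e = \<delta>\<^sup>2\<close>, the PDE becomes a first order equation along
  \<open>\<alpha> + \<beta>\<close> for \<open>S(\<alpha>, \<beta>) = a(\<alpha>) - e b(\<beta>)\<close>, with general solution
  \<open>S = (P(g(\<alpha> + \<beta>)) + \<psi>(\<alpha> - \<beta>)) / \<phi>(g(\<alpha> + \<beta>))\<close>, where \<open>P' = Q / \<phi>\<close> and \<open>\<psi>\<close> is arbitrary. The linear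
  equation for \<open>Q\<close> is exactly what makes \<open>S\<^sub>\<alpha>\<^sub>\<beta> = 0\<close> reduce to \<open>\<psi>'' = m \<psi> + K\<close> with constants
  \<open>m = \<phi>'\<^sup>2 - k \<phi>\<^sup>2\<close> and \<open>K = Q' \<phi> - 2 Q \<phi>' + m P\<close>. Then \<open>S\<close> splits into \<open>a\<close> and \<open>- e b\<close>, and the free
  constants make \<open>a\<close> and \<open>b\<close> positive near \<open>0\<close>.
\<close>

section \<open>Finitely often differentiable functions\<close>

text \<open>Frechet derivatives evaluated in fixed directions let one notion serve for functions on
  the line and on the plane. On an open set, having every order means smoothness, and closure
  properties follow by induction on the order without formulas for higher derivatives.\<close>

primrec ndiff_on :: "nat \<Rightarrow> 'a::real_normed_vector set \<Rightarrow> ('a \<Rightarrow> real) \<Rightarrow> bool" where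
  "ndiff_on 0 S f \<longleftrightarrow> True"
| "ndiff_on (Suc n) S f \<longleftrightarrow>
     (\<exists>D. (\<forall>x\<in>S. (f has_derivative D x) (at x)) \<and> (\<forall>v. ndiff_on n S (\<lambda>x. D x v)))"

lemma ndiff_on_SucI:
  assumes "\<And>x. x \<in> S \<Longrightarrow> (f has_derivative D x) (at x)"
    and "\<And>v. ndiff_on n S (\<lambda>x. D x v)"
  shows "ndiff_on (Suc n) S f"
  using assms by auto

lemma ndiff_on_SucD: "ndiff_on (Suc n) S f \<Longrightarrow> ndiff_on n S f"
proof (induction n arbitrary: f)
  case 0
  then show ?case by simp
next
  case (Suc n)
  from Suc.prems obtain D where D: "\<forall>x\<in>S. (f has_derivative D x) (at x)"
    and n: "\<And>v. ndiff_on (Suc n) S (\<lambda>x. D x v)"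
    by (subst (asm) ndiff_on.simps(2)) blast
  show ?case
    by (rule ndiff_on_SucI[where D = D]) (use D n Suc.IH in auto)
qed

lemma ndiff_on_cong:
  assumes "open S" "\<And>x. x \<in> S \<Longrightarrow> f x = g x" "ndiff_on n S f"
  shows "ndiff_on n S g"
proof (cases n)
  case (Suc k)
  with assms(3) obtain D where D: "\<forall>x\<in>S. (f has_derivative D x) (at x)"
    and n: "\<And>v. ndiff_on k S (\<lambda>x. D x v)"
    by auto
  have "(g has_derivative D x) (at x)" if "x \<in> S" for x
    by (rule has_derivative_transform_within_open[OF bspec[OF D that] assms(1) that assms(2)])
  with n Suc show ?thesis by auto
qed simp

lemma ndiff_on_subset:
  assumes "ndiff_on n S f" "T \<subseteq> S"
  shows "ndiff_on n T f"
  using assms(1)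
proof (induction n arbitrary: f)
  case (Suc n)
  then obtain D where D: "\<forall>x\<in>S. (f has_derivative D x) (at x)" "\<And>v. ndiff_on n S (\<lambda>x. D x v)"
    by auto
  show ?case
    by (rule ndiff_on_SucI[where D = D]) (use D assms(2) Suc.IH in auto)
qed simp

lemma ndiff_on_const: "ndiff_on n S (\<lambda>x. c)"
proof (induction n arbitrary: c)
  case (Suc n)
  show ?case
    by (rule ndiff_on_SucI[where D = "\<lambda>x v. 0"]) (use Suc in auto)
qed simp

lemma ndiff_on_linear:
  assumes "bounded_linear h"
  shows "ndiff_on n S h"
proof (cases n)
  case (Suc k)
  show ?thesis unfolding Suc
    by (rule ndiff_on_SucI[where D = "\<lambda>x. h"])
      (use assms in \<open>auto intro: bounded_linear_imp_has_derivative ndiff_on_const\<close>)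
qed simp

lemma ndiff_on_add:
  assumes "ndiff_on n S f" "ndiff_on n S g"
  shows "ndiff_on n S (\<lambda>x. f x + g x)"
  using assms
proof (induction n arbitrary: f g)
  case (Suc n)
  from Suc.prems obtain D E
    where D: "\<forall>x\<in>S. (f has_derivative D x) (at x)" "\<And>v. ndiff_on n S (\<lambda>x. D x v)"
      and E: "\<forall>x\<in>S. (g has_derivative E x) (at x)" "\<And>v. ndiff_on n S (\<lambda>x. E x v)"
    by auto
  show ?case
    by (rule ndiff_on_SucI[where D = "\<lambda>x v. D x v + E x v"])
      (use D E Suc.IH in \<open>auto intro!: has_derivative_add\<close>)
qed simp

lemma ndiff_on_mult:
  assumes "ndiff_on n S f" "ndiff_on n S g"
  shows "ndiff_on n S (\<lambda>x. f x * g x)"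
  using assms
proof (induction n arbitrary: f g)
  case (Suc n)
  from Suc.prems obtain D E
    where D: "\<forall>x\<in>S. (f has_derivative D x) (at x)" "\<And>v. ndiff_on n S (\<lambda>x. D x v)"
      and E: "\<forall>x\<in>S. (g has_derivative E x) (at x)" "\<And>v. ndiff_on n S (\<lambda>x. E x v)"
    by auto
  show ?case
    by (rule ndiff_on_SucI[where D = "\<lambda>x v. f x * E x v + D x v * g x"])
      (use D E Suc.IH ndiff_on_SucD[OF Suc.prems(1)] ndiff_on_SucD[OF Suc.prems(2)]
        in \<open>auto intro!: has_derivative_mult ndiff_on_add\<close>)
qed simp

lemma ndiff_on_diff:
  assumes "ndiff_on n S f" "ndiff_on n S g"
  shows "ndiff_on n S (\<lambda>x. f x - g x)"
  using ndiff_on_add[OF assms(1) ndiff_on_mult[OF ndiff_on_const[of _ _ "-1"] assms(2)]] by simp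

lemma ndiff_on_inverse:
  assumes "ndiff_on n S f" "\<And>x. x \<in> S \<Longrightarrow> f x \<noteq> 0"
  shows "ndiff_on n S (\<lambda>x. inverse (f x))"
  using assms(1)
proof (induction n)
  case (Suc n)
  from Suc.prems obtain D
    where D: "\<forall>x\<in>S. (f has_derivative D x) (at x)" "\<And>v. ndiff_on n S (\<lambda>x. D x v)"
    by auto
  \<comment> \<open>The derivative of \<open>inverse (f x)\<close> contains
    \<open>inverse (f x)\<close> itself, and there the lower order is enough.\<close>
  have IH: "ndiff_on n S (\<lambda>x. inverse (f x))"
    by (rule Suc.IH[OF ndiff_on_SucD[OF Suc.prems]])
  show ?case
  proof (rule ndiff_on_SucI[where D = "\<lambda>x v. (- 1) * (inverse (f x) * D x v * inverse (f x))"])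
    show "((\<lambda>x. inverse (f x)) has_derivative
        (\<lambda>v. (- 1) * (inverse (f x) * D x v * inverse (f x)))) (at x)" if "x \<in> S" for x
      using Deriv.has_derivative_inverse[OF assms(2)[OF that] bspec[OF D(1) that]] by simp
    show "ndiff_on n S (\<lambda>x. (- 1) * (inverse (f x) * D x v * inverse (f x)))" for v
      by (intro ndiff_on_mult ndiff_on_const IH D)
  qed
qed simp

lemma ndiff_on_divide:
  assumes "ndiff_on n S f" "ndiff_on n S g" "\<And>x. x \<in> S \<Longrightarrow> g x \<noteq> 0"
  shows "ndiff_on n S (\<lambda>x. f x / g x)"
  unfolding divide_inverse by (intro ndiff_on_mult ndiff_on_inverse assms)

text \<open>By the chain rule the derivative in direction \<open>v\<close> is the product of
  \<open>E (f x) 1\<close> and \<open>D x v\<close>. The first factor is again a composition with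
  \<open>f\<close>, so the induction generalises over \<open>h\<close> while \<open>f\<close> stays
  fixed.\<close>

lemma ndiff_on_compose:
  fixes h :: "real \<Rightarrow> real"
  assumes "ndiff_on n T h" "ndiff_on n S f" "\<And>x. x \<in> S \<Longrightarrow> f x \<in> T"
  shows "ndiff_on n S (\<lambda>x. h (f x))"
  using assms(1,2)
proof (induction n arbitrary: h)
  case (Suc n)
  from Suc.prems obtain D E
    where D: "\<forall>x\<in>S. (f has_derivative D x) (at x)" "\<And>v. ndiff_on n S (\<lambda>x. D x v)"
      and E: "\<forall>x\<in>T. (h has_derivative E x) (at x)" "\<And>v. ndiff_on n T (\<lambda>x. E x v)"
    by auto
  show ?case
  proof (rule ndiff_on_SucI[where D = "\<lambda>x v. E (f x) 1 * D x v"])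
    fix x assume x: "x \<in> S"
    have E': "(h has_derivative E (f x)) (at (f x))"
      using E(1) assms(3)[OF x] by blast
    \<comment> \<open>A linear map on the line is multiplication by its value at
      \<open>1\<close>.\<close>
    have "E (f x) = (\<lambda>v. E (f x) 1 * v)"
    proof
      fix v
      show "E (f x) v = E (f x) 1 * v"
        using linear_scale[OF has_derivative_linear[OF E'], of v 1] by (simp add: mult.commute)
    qed
    with has_derivative_compose[OF bspec[OF D(1) x] E']
    show "((\<lambda>x. h (f x)) has_derivative (\<lambda>v. E (f x) 1 * D x v)) (at x)"
      by metis
  next
    fix v
    show "ndiff_on n S (\<lambda>x. E (f x) 1 * D x v)"
      by (rule ndiff_on_mult[OF Suc.IH[OF E(2) ndiff_on_SucD[OF Suc.prems(2)]] D(2)])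
  qed
qed simp

lemma ndiff_on_Suc_real:
  fixes f :: "real \<Rightarrow> real"
  assumes "\<And>x. x \<in> S \<Longrightarrow> (f has_real_derivative f' x) (at x)" "ndiff_on n S f'"
  shows "ndiff_on (Suc n) S f"
  by (rule ndiff_on_SucI[where D = "\<lambda>x v. f' x * v"])
    (use assms in \<open>auto simp: has_field_derivative_def intro!: ndiff_on_mult ndiff_on_const\<close>)

lemma ndiff_on_sqrt: "ndiff_on n {0<..} sqrt"
proof (induction n)
  case (Suc n)
  show ?case
    by (rule ndiff_on_Suc_real[where f' = "\<lambda>x. inverse (sqrt x) / 2"])
      (use Suc in \<open>auto intro!: ndiff_on_divide ndiff_on_inverse ndiff_on_const DERIV_real_sqrt\<close>)
qed simp

text \<open>Bootstrapping: if \<open>g\<close> has order \<open>n\<close>, so has its derivative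
  \<open>h (g x)\<close>, which raises the order of \<open>g\<close> by one.\<close>

lemma ndiff_on_autonomous:
  assumes "\<And>x. x \<in> S \<Longrightarrow> (g has_real_derivative h (g x)) (at x)" "\<And>x. x \<in> S \<Longrightarrow> g x \<in> T"
    and "\<And>n. ndiff_on n T h"
  shows "ndiff_on n S g"
proof (induction n)
  case (Suc n)
  show ?case
    by (rule ndiff_on_Suc_real[OF assms(1) ndiff_on_compose[OF assms(3) Suc assms(2)]])
qed simp

text \<open>The same bootstrapping for a linear second order equation written as a system; the
  orders of \<open>f\<close> and \<open>g\<close> rise together.\<close>

lemma ndiff_on_second_order:
  assumes "\<And>x. x \<in> S \<Longrightarrow> (f has_real_derivative g x) (at x)"
    and "\<And>x. x \<in> S \<Longrightarrow> (g has_real_derivative k * f x + c) (at x)"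
  shows "ndiff_on n S f" "ndiff_on n S g"
proof -
  have "ndiff_on n S f \<and> ndiff_on n S g"
  proof (induction n)
    case (Suc n)
    have "ndiff_on n S (\<lambda>x. k * f x + c)"
      using Suc by (intro ndiff_on_add ndiff_on_mult ndiff_on_const) auto
    then show ?case
      using Suc ndiff_on_Suc_real[OF assms(1)] ndiff_on_Suc_real[OF assms(2)] by blast
  qed simp
  then show "ndiff_on n S f" "ndiff_on n S g" by auto
qed

lemma ndiff_on_1D:
  assumes "ndiff_on 1 S f"
  shows "f differentiable_on S"
proof (rule differentiable_at_imp_differentiable_on)
  fix x assume "x \<in> S"
  moreover obtain D where "\<forall>x\<in>S. (f has_derivative D x) (at x)"
    using assms unfolding One_nat_def ndiff_on.simps by blast
  ultimately show "f differentiable at x"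
    unfolding differentiable_def by blast
qed

section \<open>Agreement with smoothness by iterated derivatives and iterated partial
  derivatives\<close>

lemma smooth_onI:
  assumes "open S" "\<And>n. ndiff_on n S f"
  shows "smooth_on S f"
proof -
  \<comment> \<open>Each differentiation costs one order, which is harmless once every order is
    claimed for every iterated derivative.\<close>
  have *: "\<forall>n. ndiff_on n S ((deriv ^^ k) f)" for k
  proof (induction k)
    case 0
    then show ?case using assms(2) by simp
  next
    case (Suc k)
    show ?case
    proof
      fix n
      obtain D where D: "\<forall>x\<in>S. ((deriv ^^ k) f has_derivative D x) (at x)"
        "\<And>v. ndiff_on n S (\<lambda>x. D x v)"
        using spec[OF Suc, of "Suc n"] unfolding ndiff_on.simps by blast
      have "D x 1 = (deriv ^^ Suc k) f x" if "x \<in> S" for x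
      proof -
        have d: "((deriv ^^ k) f has_derivative D x) (at x)"
          using D(1) that by blast
        have "D x = (\<lambda>v. D x 1 * v)"
        proof
          fix v
          show "D x v = D x 1 * v"
            using linear_scale[OF has_derivative_linear[OF d], of v 1] by (simp add: mult.commute)
        qed
        with d have "((deriv ^^ k) f has_real_derivative D x 1) (at x)"
          by (metis has_field_derivative_def)
        then show ?thesis by (simp add: DERIV_imp_deriv)
      qed
      then show "ndiff_on n S ((deriv ^^ Suc k) f)"
        by (rule ndiff_on_cong[OF assms(1) _ D(2)[of 1]])
    qed
  qed
  have "(deriv ^^ k) f differentiable_on S" for k
    using ndiff_on_1D[of S] * by blast
  then show ?thesis by (simp add: smooth_on_def)
qed

lemma smooth_onD:
  assumes "open S" "smooth_on S f"
  shows "ndiff_on n S f"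
proof -
  have "\<forall>k. ndiff_on n S ((deriv ^^ k) f)"
  proof (induction n)
    case (Suc n)
    show ?case
    proof
      fix k
      have "(deriv ^^ k) f differentiable_on S" using assms(2) by (simp add: smooth_on_def)
      then have "((deriv ^^ k) f has_real_derivative (deriv ^^ Suc k) f x) (at x)" if "x \<in> S" for x
        using that assms(1)
        by (simp add: differentiable_on_eq_differentiable_at DERIV_deriv_iff_real_differentiable)
      then show "ndiff_on (Suc n) S ((deriv ^^ k) f)"
        by (rule ndiff_on_Suc_real[OF _ spec[OF Suc, of "Suc k"]])
    qed
  qed simp
  from spec[OF this, of 0] show ?thesis by simp
qed

lemma partials_of_has_derivative:
  assumes "(w has_derivative D) (at z)"
  shows "dx w z = D (1, 0)" "dy w z = D (0, 1)"
proof -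
  obtain x y where z: "z = (x, y)" by force
  have lin: "linear D" by (rule has_derivative_linear[OF assms])
  have "((\<lambda>s. w (s, y)) has_derivative (\<lambda>h. D (h, 0))) (at x)"
  proof -
    have "((\<lambda>s. (s, y)) has_derivative (\<lambda>h. (h, 0))) (at x)"
      by (intro has_derivative_Pair has_derivative_ident has_derivative_const)
    from has_derivative_compose[OF this, of w D] show ?thesis
      using assms z by simp
  qed
  moreover have "(\<lambda>h. D (h, 0)) = (*) (D (1, 0))"
  proof
    fix h
    show "D (h, 0) = D (1, 0) * h"
      using linear_scale[OF lin, of h "(1, 0)"] by (simp add: mult.commute)
  qed
  ultimately have "((\<lambda>s. w (s, y)) has_real_derivative D (1, 0)) (at x)"
    by (simp add: has_field_derivative_def)
  then show "dx w z = D (1, 0)" by (simp add: dx_def z DERIV_imp_deriv)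
  have "((\<lambda>s. w (x, s)) has_derivative (\<lambda>h. D (0, h))) (at y)"
  proof -
    have "((\<lambda>s. (x, s)) has_derivative (\<lambda>h. (0, h))) (at y)"
      by (intro has_derivative_Pair has_derivative_ident has_derivative_const)
    from has_derivative_compose[OF this, of w D] show ?thesis
      using assms z by simp
  qed
  moreover have "(\<lambda>h. D (0, h)) = (*) (D (0, 1))"
  proof
    fix h
    show "D (0, h) = D (0, 1) * h"
      using linear_scale[OF lin, of h "(0, 1)"] by (simp add: mult.commute)
  qed
  ultimately have "((\<lambda>s. w (x, s)) has_real_derivative D (0, 1)) (at y)"
    by (simp add: has_field_derivative_def)
  then show "dy w z = D (0, 1)" by (simp add: dy_def z DERIV_imp_deriv)
qed

lemma smooth2_onI:
  assumes "open U" "\<And>n. ndiff_on n U w"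
  shows "smooth2_on U w"
  unfolding smooth2_on_def
proof
  \<comment> \<open>The partial derivatives are the total derivative in the coordinate directions,
    so again one order is lost.\<close>
  have step: "ndiff_on n U (dx v) \<and> ndiff_on n U (dy v)" if "ndiff_on (Suc n) U v" for n v
  proof -
    from that obtain D where D: "\<forall>x\<in>U. (v has_derivative D x) (at x)"
      "\<And>h. ndiff_on n U (\<lambda>x. D x h)"
      unfolding ndiff_on.simps by blast
    show ?thesis
      using D(1) ndiff_on_cong[OF assms(1) _ D(2)[of "(1, 0)"], of "dx v"]
        ndiff_on_cong[OF assms(1) _ D(2)[of "(0, 1)"], of "dy v"]
      by (metis partials_of_has_derivative)
  qed
  fix v assume "v \<in> iterated_partials w"
  then have "\<forall>n. ndiff_on n U v"
    by induction (use assms(2) step in blast)+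
  then show "v differentiable_on U" using ndiff_on_1D by blast
qed


section \<open>Compatibility\<close>

text \<open>Since \<open>k\<close> is constant, the third order jets become
  \<open>q (k p^2 + F r)\<close> and \<open>p (e k q^2 + F (r - Q) + Q1)\<close>. In the difference
  of their cross derivatives everything cancels except
  \<open>p q (Q'' - F Q' - (F' + 2 k) Q)\<close>, and \<open>F' + 2 k = 3 k - F^2\<close>.\<close>

lemma compatible_if_ode:
  assumes "open I" and e: "Re (\<delta>\<^sup>2) \<noteq> 0"
    and F: "\<And>u. u \<in> I \<Longrightarrow> (F has_real_derivative k - (F u)\<^sup>2) (at u)"
    and Q: "\<And>u. u \<in> I \<Longrightarrow> (Q has_real_derivative Q1 u) (at u)"
    and Q1: "\<And>u. u \<in> I \<Longrightarrow> (Q1 has_real_derivative F u * Q1 u + (3 * k - (F u)\<^sup>2) * Q u) (at u)"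
  shows "compatible \<delta> Q F I"
  unfolding compatible_def
proof (intro ballI allI)
  fix u p q r assume u: "u \<in> I"
  define e where "e = Re (\<delta>\<^sup>2)"
  have e0: "e \<noteq> 0" using e by (simp add: e_def)
  have dF: "deriv (\<lambda>s. F s * p * q) s = (k - (F s)\<^sup>2) * p * q"
    "deriv (\<lambda>p. F s * p * q) p = F s * q"
    "deriv (\<lambda>q. F s * p * q) q = F s * p" if "s \<in> I" for s p q
    by (rule DERIV_imp_deriv; auto intro!: derivative_eq_intros F that)+
  have xxy: "jet_xxy F s p q r = q * (k * p\<^sup>2 + F s * r)" if "s \<in> I" for s p q r
    unfolding jet_xxy_def total_deriv1_def jet_xy_def dF[OF that]
    by (simp add: power2_eq_square algebra_simps)
  have xxx: "jet_xxx \<delta> Q F s p q r = p * (e * k * q\<^sup>2 + F s * (r - Q s) + Q1 s)"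
    if "s \<in> I" for s p q r
    using e0
    unfolding jet_xxx_def jet_xyy_def total_deriv1_def jet_xy_def jet_yy_def e_def[symmetric]
      dF[OF that] DERIV_imp_deriv[OF Q[OF that]]
    by (simp add: power2_eq_square field_simps)
  \<comment> \<open>The simplified jets are valid only on \<open>I\<close>; to differentiate them in
    \<open>u\<close> they must agree with the jets near \<open>u\<close>, which openness
    provides.\<close>
  have near: "\<forall>\<^sub>F s in nhds u. s \<in> I"
    using \<open>open I\<close> u by (rule eventually_nhds_in_open)
  define F' where "F' = k - (F u)\<^sup>2"
  define Q2 where "Q2 = F u * Q1 u + (3 * k - (F u)\<^sup>2) * Q u"
  have du: "deriv (\<lambda>s. jet_xxx \<delta> Q F s p q r) u
      = p * (F' * (r - Q u) - F u * Q1 u + Q2)"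
  proof -
    have "deriv (\<lambda>s. jet_xxx \<delta> Q F s p q r) u
        = deriv (\<lambda>s. p * (e * k * q\<^sup>2 + F s * (r - Q s) + Q1 s)) u"
      by (rule deriv_cong_ev) (use near in \<open>auto elim!: eventually_mono simp: xxx\<close>)
    also have "\<dots> = p * (F' * (r - Q u) - F u * Q1 u + Q2)"
      unfolding F'_def Q2_def
      by (rule DERIV_imp_deriv) (auto intro!: derivative_eq_intros F Q Q1 u simp: algebra_simps)
    finally show ?thesis .
  qed
  have dp: "deriv (\<lambda>s. jet_xxx \<delta> Q F u s q r) p = e * k * q\<^sup>2 + F u * (r - Q u) + Q1 u"
    unfolding xxx[OF u] by (rule DERIV_imp_deriv) (auto intro!: derivative_eq_intros)
  have dq: "deriv (\<lambda>s. jet_xxx \<delta> Q F u p s r) q = 2 * p * e * k * q"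
    unfolding xxx[OF u] by (rule DERIV_imp_deriv) (auto intro!: derivative_eq_intros)
  have dr: "deriv (\<lambda>s. jet_xxx \<delta> Q F u p q s) r = p * F u"
    unfolding xxx[OF u] by (rule DERIV_imp_deriv) (auto intro!: derivative_eq_intros)
  have du': "deriv (\<lambda>s. jet_xxy F s p q r) u = q * F' * r"
  proof -
    have "deriv (\<lambda>s. jet_xxy F s p q r) u = deriv (\<lambda>s. q * (k * p\<^sup>2 + F s * r)) u"
      by (rule deriv_cong_ev) (use near in \<open>auto elim!: eventually_mono simp: xxy\<close>)
    also have "\<dots> = q * F' * r"
      unfolding F'_def by (rule DERIV_imp_deriv) (auto intro!: derivative_eq_intros F u)
    finally show ?thesis .
  qed
  have dp': "deriv (\<lambda>s. jet_xxy F u s q r) p = 2 * q * k * p"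
    unfolding xxy[OF u] by (rule DERIV_imp_deriv) (auto intro!: derivative_eq_intros)
  have dq': "deriv (\<lambda>s. jet_xxy F u p s r) q = k * p\<^sup>2 + F u * r"
    unfolding xxy[OF u] by (rule DERIV_imp_deriv) (auto intro!: derivative_eq_intros)
  have dr': "deriv (\<lambda>s. jet_xxy F u p q s) r = q * F u"
    unfolding xxy[OF u] by (rule DERIV_imp_deriv) (auto intro!: derivative_eq_intros)
  have et: "e * jet_yy \<delta> Q u r = r - Q u"
    using e0 by (simp add: jet_yy_def e_def)
  have "jet_xxxy \<delta> Q F u p q r = p * q * (F' * (r - Q u) - F u * Q1 u + Q2)
      + F u * p * q * (e * k * q\<^sup>2 + F u * (r - Q u) + Q1 u)
      + 2 * p * k * q * (e * jet_yy \<delta> Q u r) + p * F u * (q * (k * p\<^sup>2 + F u * r))"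
    unfolding jet_xxxy_def total_deriv2_def du dp dq dr jet_xy_def xxy[OF u]
    by (simp add: algebra_simps)
  moreover have "jet_xxyx \<delta> Q F u p q r = q * F' * r * p + 2 * q * k * p * r
      + (k * p\<^sup>2 + F u * r) * (F u * p * q)
      + q * F u * (p * (e * k * q\<^sup>2 + F u * (r - Q u) + Q1 u))"
    unfolding jet_xxyx_def total_deriv2_def du' dp' dq' dr' jet_xy_def xxx[OF u]
    by (simp add: algebra_simps)
  ultimately show "jet_xxxy \<delta> Q F u p q r = jet_xxyx \<delta> Q F u p q r"
    unfolding et F'_def Q2_def by (simp add: power2_eq_square algebra_simps)
qed


section \<open>Autonomous differential equations\<close>

lemma antiderivative_near:
  fixes f :: "real \<Rightarrow> real"
  assumes "open I" "u \<in> I" "continuous_on I f"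
  obtains d g where "d > 0" "{u - d<..<u + d} \<subseteq> I" "g u = c"
    "\<And>x. x \<in> {u - d<..<u + d} \<Longrightarrow> (g has_real_derivative f x) (at x)"
proof -
  obtain d where d: "d > 0" "cball u d \<subseteq> I"
    using assms(1,2) open_contains_cball by blast
  have sub: "{u - d..u + d} \<subseteq> I"
    using d(2) by (simp add: cball_eq_atLeastAtMost)
  obtain g where g: "\<And>x. x \<in> {u - d..u + d} \<Longrightarrow>
      (g has_vector_derivative f x) (at x within {u - d..u + d})"
    using antiderivative_continuous continuous_on_subset[OF assms(3) sub] by blast
  show thesis
  proof (rule that[of d "\<lambda>x. g x - g u + c"])
    show "{u - d<..<u + d} \<subseteq> I" using sub by force
    fix x assume x: "x \<in> {u - d<..<u + d}"
    then have "(g has_real_derivative f x) (at x within {u - d..u + d})"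
      using g[of x] by (simp add: has_real_derivative_iff_has_vector_derivative)
    moreover have "at x within {u - d..u + d} = at x"
      by (rule at_within_interior) (use x in simp)
    ultimately show "((\<lambda>x. g x - g u + c) has_real_derivative f x) (at x)"
      by (auto intro!: derivative_eq_intros)
  qed (use d in auto)
qed

lemma inj_on_if_deriv_nonzero:
  fixes f :: "real \<Rightarrow> real"
  assumes "connected I" "\<And>u. u \<in> I \<Longrightarrow> (f has_real_derivative f' u) (at u)"
    and "\<And>u. u \<in> I \<Longrightarrow> f' u \<noteq> 0"
  shows "inj_on f I"
proof -
  have False if "x \<in> I" "y \<in> I" "x < y" "f x = f y" for x y
  proof -
    have sub: "{x..y} \<subseteq> I"
      using assms(1) that connected_contains_Icc by blast
    have "\<exists>z>x. z < y \<and> f y - f x = (y - x) * f' z"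
      by (rule MVT2[OF \<open>x < y\<close>]) (use sub assms(2) in auto)
    then obtain z where "x < z" "z < y" "f y - f x = (y - x) * f' z"
      by blast
    moreover from this have "z \<in> I" using sub by auto
    ultimately show False using that assms(3) by auto
  qed
  then show ?thesis
    by (metis inj_onI linorder_neqE_linordered_idom)
qed

text \<open>Separation of variables: an antiderivative \<open>f\<close> of \<open>1 / h\<close> with
  \<open>f u = 0\<close> is injective and an open map, so its inverse is defined around
  \<open>0\<close> and has derivative \<open>h (g z)\<close>.\<close>

lemma autonomous_ode:
  fixes h :: "real \<Rightarrow> real"
  assumes "open I" "u \<in> I" "continuous_on I h" "\<And>x. x \<in> I \<Longrightarrow> h x \<noteq> 0"
  obtains r g where "r > 0" "g 0 = u" "\<And>z. z \<in> {- r<..<r} \<Longrightarrow> g z \<in> I"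
    "\<And>z. z \<in> {- r<..<r} \<Longrightarrow> (g has_real_derivative h (g z)) (at z)"
proof -
  have "continuous_on I (\<lambda>x. 1 / h x)"
    using assms(3,4) by (intro continuous_intros) auto
  then obtain d f where d: "d > 0" "{u - d<..<u + d} \<subseteq> I" and f0: "f u = 0"
    and f: "\<And>x. x \<in> {u - d<..<u + d} \<Longrightarrow> (f has_real_derivative 1 / h x) (at x)"
    using antiderivative_near[OF assms(1,2), of _ 0] by metis
  define J where "J = {u - d<..<u + d}"
  note f = f[folded J_def] and sub = d(2)[folded J_def]
  have "inj_on f J"
    by (rule inj_on_if_deriv_nonzero[OF _ f]) (use assms(4) sub in \<open>auto simp: J_def\<close>)
  moreover have cont: "continuous_on J f"
    using f by (auto intro!: continuous_at_imp_continuous_on DERIV_isCont)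
  ultimately have "open (f ` J)"
    using injective_into_1d_imp_open_map_UNIV[of J J f] by (simp add: J_def)
  moreover have "0 \<in> f ` J"
    using f0 d(1) by (force simp: J_def)
  ultimately obtain r where r: "r > 0" "ball 0 r \<subseteq> f ` J"
    using open_contains_ball by blast
  define g where "g = the_inv_into J f"
  have gf: "g (f x) = x" if "x \<in> J" for x
    using \<open>inj_on f J\<close> that by (simp add: g_def the_inv_into_f_f)
  show thesis
  proof (rule that[of r g])
    show "g 0 = u" using gf[of u] f0 d(1) by (simp add: J_def)
    fix z :: real assume "z \<in> {- r<..<r}"
    then have "z \<in> f ` J" using r(2) by (auto simp: ball_eq_greaterThanLessThan)
    then obtain x where x: "x \<in> J" "z = f x" by blast
    with gf sub show "g z \<in> I" by auto
    have "(g has_derivative (*) (h x)) (at (f x))"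
    proof (rule has_derivative_inverse_on[where S = J and f' = "\<lambda>x. (*) (1 / h x)" and g' = "\<lambda>x. (*) (h x)"])
      show "(f has_derivative (*) (1 / h x)) (at x)" if "x \<in> J" for x
        using f[OF that] by (simp add: has_field_derivative_def)
      show "(*) (1 / h x) \<circ> (*) (h x) = id"
        using assms(4)[of x] x(1) sub by (auto simp: fun_eq_iff)
    qed (use gf x in \<open>auto simp: J_def\<close>)
    then show "(g has_real_derivative h (g z)) (at z)"
      using gf x by (simp add: has_field_derivative_def)
  qed (use r in auto)
qed

text \<open>The solution is a parabola, hyperbolic or trigonometric according to the sign of
  \<open>m\<close>. The value \<open>\<psi> 0 = 0\<close> removes \<open>\<psi>\<close> from all
  later evaluations at the origin.\<close>

lemma second_order_ode:
  obtains \<psi> \<psi>' :: "real \<Rightarrow> real" where "\<psi> 0 = 0"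
    "\<And>t. (\<psi> has_real_derivative \<psi>' t) (at t)"
    "\<And>t. (\<psi>' has_real_derivative m * \<psi> t + c) (at t)"
proof (cases "m = 0")
  case True
  show thesis
    by (rule that[of "\<lambda>t. c * t\<^sup>2 / 2" "\<lambda>t. c * t"])
      (use True in \<open>auto intro!: derivative_eq_intros\<close>)
next
  case m: False
  show thesis
  proof (cases "m > 0")
    case True
    define s where "s = sqrt m"
    have s: "m = s * s" "s \<noteq> 0" using True by (simp_all add: s_def)
    show thesis
      by (rule that[of "\<lambda>t. c / m * (cosh (s * t) - 1)" "\<lambda>t. c / m * s * sinh (s * t)"])
        (use s in \<open>auto intro!: derivative_eq_intros simp: field_simps\<close>)
  next
    case False
    define s where "s = sqrt (- m)"
    have s: "m = - (s * s)" "s \<noteq> 0" using False m by (simp_all add: s_def)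
    show thesis
      by (rule that[of "\<lambda>t. c / m * (cos (s * t) - 1)" "\<lambda>t. - (c / m * s * sin (s * t))"])
        (use s in \<open>auto intro!: derivative_eq_intros simp: field_simps\<close>)
  qed
qed


section \<open>Separated solutions\<close>

text \<open>For \<open>S(a, b) = p (a + b) + \<theta> (a + b) * \<psi> (a - b)\<close> the mixed
  derivative is \<open>p'' + \<theta>'' \<psi> - \<theta> \<psi>''\<close>, which the three
  equations make zero. Hence \<open>S(a, b) = S(a, 0) + S(0, b) - S(0, 0)\<close>. The halved
  interval keeps \<open>a + b\<close> in the domain.\<close>

lemma additive_splitting:
  fixes p p' \<theta> \<theta>' \<psi> \<psi>' :: "real \<Rightarrow> real" and K m r :: real
  assumes p: "\<And>s. s \<in> {- r<..<r} \<Longrightarrow> (p has_real_derivative p' s) (at s)"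
    and p': "\<And>s. s \<in> {- r<..<r} \<Longrightarrow> (p' has_real_derivative K * \<theta> s) (at s)"
    and \<theta>: "\<And>s. s \<in> {- r<..<r} \<Longrightarrow> (\<theta> has_real_derivative \<theta>' s) (at s)"
    and \<theta>': "\<And>s. s \<in> {- r<..<r} \<Longrightarrow> (\<theta>' has_real_derivative m * \<theta> s) (at s)"
    and \<psi>: "\<And>t. (\<psi> has_real_derivative \<psi>' t) (at t)"
    and \<psi>': "\<And>t. (\<psi>' has_real_derivative m * \<psi> t + K) (at t)"
    and "\<psi> 0 = 0" and \<alpha>: "\<alpha> \<in> {- (r / 2)<..<r / 2}" and \<beta>: "\<beta> \<in> {- (r / 2)<..<r / 2}"
  shows "p \<alpha> + \<theta> \<alpha> * \<psi> \<alpha> + (p \<beta> + \<theta> \<beta> * \<psi> (- \<beta>)) - p 0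
      = p (\<alpha> + \<beta>) + \<theta> (\<alpha> + \<beta>) * \<psi> (\<alpha> - \<beta>)" (is ?sum)
    and "(p' \<alpha> + \<theta>' \<alpha> * \<psi> \<alpha> + \<theta> \<alpha> * \<psi>' \<alpha>) + (p' \<beta> + \<theta>' \<beta> * \<psi> (- \<beta>) - \<theta> \<beta> * \<psi>' (- \<beta>))
      = 2 * (p' (\<alpha> + \<beta>) + \<theta>' (\<alpha> + \<beta>) * \<psi> (\<alpha> - \<beta>))" (is ?derivs)
proof -
  let ?J = "{- (r / 2)<..<r / 2}"
  have 0: "0 \<in> ?J" using \<alpha> by auto
  have J: "a + b \<in> {- r<..<r}" if "a \<in> ?J" "b \<in> ?J" for a b
    using that by auto
  have const: "F a = F b"
    if "\<And>t. t \<in> ?J \<Longrightarrow> (F has_real_derivative 0) (at t)" "a \<in> ?J" "b \<in> ?J" for F a b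
    by (rule DERIV_isconst3[of "- (r / 2)" "r / 2"]) (use that in auto)
  \<comment> \<open>These are the two partial derivatives of \<open>S\<close>; in their sum the
    terms with \<open>\<psi>'\<close> cancel, which gives the second claim.\<close>
  define Sa where "Sa a b = p' (a + b) + \<theta>' (a + b) * \<psi> (a - b) + \<theta> (a + b) * \<psi>' (a - b)" for a b
  define Sb where "Sb a b = p' (a + b) + \<theta>' (a + b) * \<psi> (a - b) - \<theta> (a + b) * \<psi>' (a - b)" for a b
  note D = DERIV_chain2[of p] DERIV_chain2[of p'] DERIV_chain2[of \<theta>] DERIV_chain2[of \<theta>']
    DERIV_chain2[OF \<psi>] DERIV_chain2[OF \<psi>']
  have Sa: "Sa a b = Sa a 0" if "a \<in> ?J" "b \<in> ?J" for a b
  proof (rule const[of "Sa a"])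
    fix t assume "t \<in> ?J"
    then have t: "a + t \<in> {- r<..<r}" using J that by blast
    show "(Sa a has_real_derivative 0) (at t)"
      unfolding Sa_def
      by (rule derivative_eq_intros p'[OF t] \<theta>[OF t] \<theta>'[OF t] D refl)+ (simp add: algebra_simps)
  qed (use that 0 in auto)
  have Sb: "Sb a b = Sb 0 b" if "a \<in> ?J" "b \<in> ?J" for a b
  proof (rule const[of "\<lambda>a. Sb a b"])
    fix t assume "t \<in> ?J"
    then have t: "t + b \<in> {- r<..<r}" using J that by blast
    show "((\<lambda>a. Sb a b) has_real_derivative 0) (at t)"
      unfolding Sb_def
      by (rule derivative_eq_intros p'[OF t] \<theta>[OF t] \<theta>'[OF t] D refl)+ (simp add: algebra_simps)
  qed (use that 0 in auto)
  define S where "S a b = p (a + b) + \<theta> (a + b) * \<psi> (a - b)" for a b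
  have S: "((\<lambda>a. S a b) has_real_derivative Sa a b) (at a)" if "a \<in> ?J" "b \<in> ?J" for a b
    unfolding S_def Sa_def
    by (rule derivative_eq_intros p[OF J[OF that]] \<theta>[OF J[OF that]] D refl)+ (simp add: algebra_simps)
  have "S \<alpha> \<beta> - S \<alpha> 0 = S 0 \<beta> - S 0 0"
  proof (rule const[of "\<lambda>a. S a \<beta> - S a 0"])
    fix t assume "t \<in> ?J"
    then show "((\<lambda>a. S a \<beta> - S a 0) has_real_derivative 0) (at t)"
      using DERIV_diff[OF S[of t \<beta>] S[of t 0]] Sa[of t \<beta>] \<beta> 0 by simp
  qed (use \<alpha> 0 in auto)
  then show ?sum
    using \<open>\<psi> 0 = 0\<close> by (simp add: S_def)
  show ?derivs
    using Sa[OF \<alpha> \<beta>] Sb[OF \<alpha> \<beta>] by (simp add: Sa_def Sb_def)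
qed

lemma separated_derivs:
  fixes \<phi> \<phi>' g A a a' :: "real \<Rightarrow> real"
  assumes g: "(g has_real_derivative \<phi> (g (A x + c))) (at (A x + c))"
    and A: "(A has_real_derivative sqrt (a (A x))) (at x)"
    and \<phi>: "(\<phi> has_real_derivative \<phi>' (g (A x + c))) (at (g (A x + c)))"
    and a: "(a has_real_derivative a' (A x)) (at (A x))" and "a (A x) > 0"
  shows "((\<lambda>x. g (A x + c)) has_real_derivative \<phi> (g (A x + c)) * sqrt (a (A x))) (at x)"
    and "((\<lambda>x. \<phi> (g (A x + c)) * sqrt (a (A x))) has_real_derivative
      \<phi> (g (A x + c)) * \<phi>' (g (A x + c)) * a (A x) + \<phi> (g (A x + c)) * a' (A x) / 2) (at x)"
proof -
  have "((\<lambda>x. A x + c) has_real_derivative sqrt (a (A x))) (at x)"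
    using A by (auto intro!: derivative_eq_intros)
  from DERIV_chain2[OF g this]
  show w: "((\<lambda>x. g (A x + c)) has_real_derivative \<phi> (g (A x + c)) * sqrt (a (A x))) (at x)" .
  have s: "((\<lambda>x. sqrt (a (A x))) has_real_derivative a' (A x) / 2) (at x)"
    using DERIV_chain2[OF DERIV_real_sqrt[OF \<open>a (A x) > 0\<close>] DERIV_chain2[OF a A]] \<open>a (A x) > 0\<close>
    by (simp add: field_simps)
  show "((\<lambda>x. \<phi> (g (A x + c)) * sqrt (a (A x))) has_real_derivative
      \<phi> (g (A x + c)) * \<phi>' (g (A x + c)) * a (A x) + \<phi> (g (A x + c)) * a' (A x) / 2) (at x)"
    by (rule DERIV_cong[OF DERIV_mult[OF DERIV_chain2[OF \<phi> w] s]])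
      (use \<open>a (A x) > 0\<close> in \<open>simp add: field_simps\<close>)
qed

lemma separated_solution:
  fixes \<phi> \<phi>' Q Q1 f :: "real \<Rightarrow> real" and k :: real and \<delta> :: complex
  assumes "\<delta> \<in> {1, \<i>}" and "open I" and u0: "u0 \<in> I"
    and \<phi>: "\<And>u. u \<in> I \<Longrightarrow> (\<phi> has_real_derivative \<phi>' u) (at u)"
    and \<phi>': "\<And>u. u \<in> I \<Longrightarrow> (\<phi>' has_real_derivative k * \<phi> u) (at u)"
    and nz: "\<And>u. u \<in> I \<Longrightarrow> \<phi> u \<noteq> 0"
    and Q: "\<And>u. u \<in> I \<Longrightarrow> (Q has_real_derivative Q1 u) (at u)"
    and Q1: "\<And>u. u \<in> I \<Longrightarrow>
      (Q1 has_real_derivative \<phi>' u / \<phi> u * Q1 u + (3 * k - (\<phi>' u / \<phi> u)\<^sup>2) * Q u) (at u)"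
    and smooth: "\<And>n. ndiff_on n I Q"
    and f: "\<And>u. u \<in> I \<Longrightarrow> (f has_real_derivative 1 / \<phi> u) (at u)"
  shows "\<exists>U w. open U \<and> connected U \<and> U \<noteq> {} \<and> pde_solution \<delta> Q I U w \<and> separated_by f U w
    \<and> (\<forall>z\<in>U. dx w z \<noteq> 0 \<and> dy w z \<noteq> 0)"
proof -
  define e where "e = Re (\<delta>\<^sup>2)"
  have e: "e = 1 \<or> e = - 1" using \<open>\<delta> \<in> {1, \<i>}\<close> by (auto simp: e_def)
  have n\<phi>: "ndiff_on n I \<phi>" for n
    by (rule ndiff_on_second_order(1)[where g = \<phi>' and k = k and c = 0]) (use \<phi> \<phi>' in auto)
  have cont\<phi>: "continuous_on I \<phi>"
    using \<phi> by (auto intro!: continuous_at_imp_continuous_on DERIV_isCont)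
  have "continuous_on I (\<lambda>u. Q u / \<phi> u)"
    using Q nz by (intro continuous_intros cont\<phi>)
      (auto intro!: continuous_at_imp_continuous_on DERIV_isCont)
  \<comment> \<open>The constant of integration is chosen so that \<open>P / \<phi>\<close> equals
    \<open>1\<close> at \<open>u0\<close>; this fixes \<open>S = 1\<close> at the origin.\<close>
  then obtain d P where d: "d > 0" "{u0 - d<..<u0 + d} \<subseteq> I" and P0: "P u0 = \<phi> u0"
    and P_deriv: "\<And>u. u \<in> {u0 - d<..<u0 + d} \<Longrightarrow> (P has_real_derivative Q u / \<phi> u) (at u)"
    by (rule antiderivative_near[OF \<open>open I\<close> u0, where c = "\<phi> u0"]) blast
  define J where "J = {u0 - d<..<u0 + d}"
  have J: "open J" "connected J" "u0 \<in> J" "J \<subseteq> I"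
    using d by (auto simp: J_def)
  note P = P_deriv[folded J_def]
  have nP: "ndiff_on n J P" for n
  proof (cases n)
    case (Suc k)
    have "ndiff_on k I (\<lambda>u. Q u / \<phi> u)"
      by (intro ndiff_on_divide smooth n\<phi> nz)
    then show ?thesis
      using ndiff_on_Suc_real[OF P ndiff_on_subset[OF _ J(4)]] Suc by blast
  qed simp

  \<comment> \<open>The first integral (energy) of \<open>\<phi>'' = k \<phi>\<close>.\<close>
  have "(\<lambda>u. (\<phi>' u)\<^sup>2 - k * (\<phi> u)\<^sup>2) constant_on J"
  proof (rule has_field_derivative_0_imp_constant_on)
    fix u assume "u \<in> J"
    then have u: "u \<in> I" using J by blast
    show "((\<lambda>u. (\<phi>' u)\<^sup>2 - k * (\<phi> u)\<^sup>2) has_real_derivative 0) (at u)"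
      by (rule derivative_eq_intros \<phi>[OF u] \<phi>'[OF u] refl)+ simp
  qed (use J in auto)
  then obtain m where m: "\<And>u. u \<in> J \<Longrightarrow> (\<phi>' u)\<^sup>2 - k * (\<phi> u)\<^sup>2 = m"
    by (auto simp: constant_on_def)
  \<comment> \<open>Inserting the linear equation for \<open>Q\<close>, the \<open>Q1\<close> terms
    of the derivative cancel and the rest is \<open>Q / \<phi>\<close> times
    \<open>m - (\<phi>'^2 - k \<phi>^2)\<close>.\<close>
  have "(\<lambda>u. Q1 u * \<phi> u - 2 * Q u * \<phi>' u + m * P u) constant_on J"
  proof (rule has_field_derivative_0_imp_constant_on)
    fix u assume uJ: "u \<in> J"
    then have u: "u \<in> I" using J by blast
    show "((\<lambda>u. Q1 u * \<phi> u - 2 * Q u * \<phi>' u + m * P u) has_real_derivative 0) (at u)"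
      by (rule derivative_eq_intros \<phi>[OF u] \<phi>'[OF u] Q[OF u] Q1[OF u] P[OF uJ] refl)+
        (use nz[OF u] in \<open>simp add: m[OF uJ, symmetric] field_simps power2_eq_square\<close>)
  qed (use J in auto)
  then obtain K where K: "\<And>u. u \<in> J \<Longrightarrow> Q1 u * \<phi> u - 2 * Q u * \<phi>' u + m * P u = K"
    by (auto simp: constant_on_def)

  obtain \<psi> \<psi>' where \<psi>0: "\<psi> 0 = 0" and \<psi>: "\<And>t. (\<psi> has_real_derivative \<psi>' t) (at t)"
    and \<psi>': "\<And>t. (\<psi>' has_real_derivative m * \<psi> t + K) (at t)"
    by (rule second_order_ode[of m K]) blast
  have n\<psi>: "ndiff_on n UNIV \<psi>" for n
    by (rule ndiff_on_second_order(1)[where g = \<psi>' and k = m and c = K]) (use \<psi> \<psi>' in auto)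

  obtain r g where r: "r > 0" and g0: "g 0 = u0" and gJ: "\<And>s. s \<in> {- r<..<r} \<Longrightarrow> g s \<in> J"
    and g: "\<And>s. s \<in> {- r<..<r} \<Longrightarrow> (g has_real_derivative \<phi> (g s)) (at s)"
    by (rule autonomous_ode[OF \<open>open J\<close> \<open>u0 \<in> J\<close> continuous_on_subset[OF cont\<phi> \<open>J \<subseteq> I\<close>]
          nz[OF subsetD[OF \<open>J \<subseteq> I\<close>]]]) blast+
  have gI: "g s \<in> I" if "s \<in> {- r<..<r}" for s
    using gJ[OF that] J by blast
  have ng: "ndiff_on n {- r<..<r} g" for n
    by (rule ndiff_on_autonomous[OF g gI n\<phi>])
  \<comment> \<open>Here \<open>f\<close> is prescribed only up to an additive constant, so it
    inverts \<open>g\<close> up to \<open>f u0\<close>.\<close>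
  have fg: "f (g s) = s + f u0" if "s \<in> {- r<..<r}" for s
  proof -
    have "((\<lambda>s. f (g s) - s) has_real_derivative 0) (at s)" if s: "s \<in> {- r<..<r}" for s
      using DERIV_diff[OF DERIV_chain2[OF f[OF gI[OF s]] g[OF s]] DERIV_ident] nz[OF gI[OF s]] by simp
    from DERIV_isconst3[OF _ that _ this, of 0] r g0 show ?thesis by simp
  qed

  \<comment> \<open>In the variable \<open>s\<close>, the functions
    \<open>\<theta> = 1 / \<phi>\<close> and \<open>p = P / \<phi>\<close> satisfy
    \<open>\<theta>'' = m \<theta>\<close> and \<open>p'' = K \<theta>\<close>, as
    \<open>additive_splitting\<close> requires.\<close>
  define \<theta> \<theta>' where "\<theta> s = 1 / \<phi> (g s)" and "\<theta>' s = - (\<phi>' (g s) * \<theta> s)" for s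
  define p p' where "p s = P (g s) * \<theta> s" and "p' s = Q (g s) * \<theta> s - \<phi>' (g s) * p s" for s
  have \<theta>: "(\<theta> has_real_derivative \<theta>' s) (at s)" if s: "s \<in> {- r<..<r}" for s
    unfolding \<theta>_def \<theta>'_def
    by (rule derivative_eq_intros DERIV_chain2[OF \<phi>[OF gI[OF s]] g[OF s]] refl)+
      (use nz[OF gI[OF s]] in \<open>auto simp: field_simps\<close>)
  have h: "((\<lambda>s. \<phi>' (g s)) has_real_derivative k * \<phi> (g s) * \<phi> (g s)) (at s)"
    if s: "s \<in> {- r<..<r}" for s
    using DERIV_chain2[OF \<phi>'[OF gI[OF s]] g[OF s]] .
  have \<theta>': "(\<theta>' has_real_derivative m * \<theta> s) (at s)" if s: "s \<in> {- r<..<r}" for s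
    unfolding \<theta>'_def[abs_def]
    by (rule derivative_eq_intros h[OF s] \<theta>[OF s] refl)+
      (simp add: \<theta>'_def m[OF gJ[OF s], symmetric] \<theta>_def nz[OF gI[OF s]] field_simps power2_eq_square)
  have p: "(p has_real_derivative p' s) (at s)" if s: "s \<in> {- r<..<r}" for s
    unfolding p_def[abs_def]
    by (rule derivative_eq_intros DERIV_chain2[OF P[OF gJ[OF s]] g[OF s]] \<theta>[OF s] refl)+
      (simp add: p'_def p_def \<theta>'_def nz[OF gI[OF s]])
  have p': "(p' has_real_derivative K * \<theta> s) (at s)" if s: "s \<in> {- r<..<r}" for s
    unfolding p'_def[abs_def]
    by (rule derivative_eq_intros DERIV_chain2[OF Q[OF gI[OF s]] g[OF s]] h[OF s] p[OF s] \<theta>[OF s] refl)+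
      (simp add: p'_def p_def \<theta>'_def \<theta>_def K[OF gJ[OF s], symmetric] m[OF gJ[OF s], symmetric]
        nz[OF gI[OF s]] field_simps power2_eq_square)
  have n\<theta>: "ndiff_on n {- r<..<r} \<theta>" for n
    unfolding \<theta>_def[abs_def] using gI nz
    by (intro ndiff_on_divide ndiff_on_const ndiff_on_compose[OF n\<phi> ng]) auto
  have np: "ndiff_on n {- r<..<r} p" for n
    unfolding p_def[abs_def] using gJ
    by (intro ndiff_on_mult n\<theta> ndiff_on_compose[OF nP ng]) auto

  \<comment> \<open>At the origin \<open>S = 1\<close>, so \<open>a = 1 - C\<close> and \<open>b = - e C\<close> there; \<open>C\<close> makes both positive.\<close>
  define C where "C = (if e = 1 then - 1 else 1 / 2 :: real)"
  define a where "a s = p s + \<theta> s * \<psi> s - C" for s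
  define a' where "a' s = p' s + \<theta>' s * \<psi> s + \<theta> s * \<psi>' s" for s
  define b where "b s = - e * (p s + \<theta> s * \<psi> (- s) - 1 + C)" for s
  define b' where "b' s = - e * (p' s + \<theta>' s * \<psi> (- s) - \<theta> s * \<psi>' (- s))" for s
  have p0: "p 0 = 1" by (simp add: p_def \<theta>_def g0 P0 nz u0)
  have a: "(a has_real_derivative a' s) (at s)" if s: "s \<in> {- r<..<r}" for s
    unfolding a_def[abs_def] a'_def
    by (rule derivative_eq_intros p[OF s] \<theta>[OF s] \<psi> refl)+ simp
  have b: "(b has_real_derivative b' s) (at s)" if s: "s \<in> {- r<..<r}" for s
    unfolding b_def[abs_def] b'_def
    by (rule derivative_eq_intros p[OF s] \<theta>[OF s] DERIV_chain2[OF \<psi>] refl)+ (simp add: algebra_simps)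
  have na: "ndiff_on n {- r<..<r} a" for n
    unfolding a_def[abs_def]
    by (intro ndiff_on_diff ndiff_on_add ndiff_on_mult np n\<theta> ndiff_on_const
        ndiff_on_subset[OF n\<psi>] subset_UNIV)
  have nb: "ndiff_on n {- r<..<r} b" for n
    unfolding b_def[abs_def]
    by (intro ndiff_on_diff ndiff_on_add ndiff_on_mult np n\<theta> ndiff_on_const
        ndiff_on_compose[OF n\<psi>] ndiff_on_linear bounded_linear_minus bounded_linear_ident UNIV_I)
  have "a 0 > 0" "b 0 > 0"
    using e by (auto simp: a_def b_def p0 \<psi>0 C_def)
  moreover have "isCont a 0" "isCont b 0"
    using a[of 0] b[of 0] r by (auto intro: DERIV_isCont)
  ultimately have "\<forall>\<^sub>F s in nhds 0. a s > 0 \<and> b s > 0"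
    by (auto intro!: eventually_conj order_tendstoD simp: isCont_def tendsto_at_iff_tendsto_nhds)
  then obtain q where q: "q > 0" "\<And>s. s \<in> {- q<..<q} \<Longrightarrow> a s > 0 \<and> b s > 0"
    by (auto simp: eventually_nhds_metric dist_real_def abs_less_iff)
  \<comment> \<open>The bound \<open>q\<close> keeps \<open>a\<close> and \<open>b\<close> positive,
    the bound \<open>r / 2\<close> keeps sums of two arguments in the domain of
    \<open>g\<close>.\<close>
  define \<rho> where "\<rho> = min q (r / 2)"
  let ?R = "{- \<rho><..<\<rho>}"
  have \<rho>: "\<rho> > 0" "?R \<subseteq> {- r<..<r}" "?R \<subseteq> {- (r / 2)<..<r / 2}"
    using q r by (auto simp: \<rho>_def)
  have pos: "a s > 0" "b s > 0" if "s \<in> ?R" for s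
    using q(2)[of s] that by (auto simp: \<rho>_def)
  have sum: "s + t \<in> {- r<..<r}" if "s \<in> ?R" "t \<in> ?R" for s t
    using that by (auto simp: \<rho>_def)
  have nsqrt: "ndiff_on n ?R (\<lambda>s. sqrt (a s))" "ndiff_on n ?R (\<lambda>s. sqrt (b s))" for n
    using pos by (auto intro!: ndiff_on_compose[OF ndiff_on_sqrt] ndiff_on_subset[OF na \<rho>(2)]
        ndiff_on_subset[OF nb \<rho>(2)])
  have cont: "continuous_on ?R (\<lambda>s. sqrt (a s))" "continuous_on ?R (\<lambda>s. sqrt (b s))"
    using a b \<rho>(2)
    by (intro continuous_on_real_sqrt continuous_at_imp_continuous_on; blast intro: DERIV_isCont)+
  have zero: "0 \<in> ?R" using \<rho> by simp
  have sqrt_nz: "sqrt (a s) \<noteq> 0" "sqrt (b s) \<noteq> 0" if "s \<in> ?R" for s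
    using pos[OF that] by simp_all
  obtain ra A where ra: "ra > 0" and "A 0 = 0" and AR: "\<And>x. x \<in> {- ra<..<ra} \<Longrightarrow> A x \<in> ?R"
    and A: "\<And>x. x \<in> {- ra<..<ra} \<Longrightarrow> (A has_real_derivative sqrt (a (A x))) (at x)"
    by (rule autonomous_ode[OF open_greaterThanLessThan zero cont(1) sqrt_nz(1)]) blast+
  obtain rb B where rb: "rb > 0" and "B 0 = 0" and BR: "\<And>y. y \<in> {- rb<..<rb} \<Longrightarrow> B y \<in> ?R"
    and B: "\<And>y. y \<in> {- rb<..<rb} \<Longrightarrow> (B has_real_derivative sqrt (b (B y))) (at y)"
    by (rule autonomous_ode[OF open_greaterThanLessThan zero cont(2) sqrt_nz(2)]) blast+
  have nA: "ndiff_on n {- ra<..<ra} A" and nB: "ndiff_on n {- rb<..<rb} B" for n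
    by (rule ndiff_on_autonomous[OF A AR nsqrt(1)] ndiff_on_autonomous[OF B BR nsqrt(2)]; assumption)+

  define U where "U = {- ra<..<ra} \<times> {- rb<..<rb}"
  define w where "w = (\<lambda>z. g (A (fst z) + B (snd z)))"
  have U: "open U" "connected U" "U \<noteq> {}"
    using ra rb by (auto simp: U_def intro!: open_Times connected_Times)
  have "ndiff_on n U w" for n
    unfolding w_def
  proof (rule ndiff_on_compose[OF ng])
    show "ndiff_on n U (\<lambda>z. A (fst z) + B (snd z))"
      by (intro ndiff_on_add ndiff_on_compose[OF nA] ndiff_on_compose[OF nB] ndiff_on_linear
          bounded_linear_fst bounded_linear_snd) (auto simp: U_def)
    show "A (fst z) + B (snd z) \<in> {- r<..<r}" if "z \<in> U" for z
      using that by (intro sum AR BR) (auto simp: U_def)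
  qed
  then have "smooth2_on U w" by (rule smooth2_onI[OF U(1)])
  have AB: "A x + B y \<in> {- r<..<r}" "B y + A x \<in> {- r<..<r}"
    and AI: "A x \<in> {- r<..<r}" "B y \<in> {- r<..<r}"
    and apos: "a (A x) > 0" "b (B y) > 0"
    if "(x, y) \<in> U" for x y
    using that AR[of x] BR[of y] sum[of "A x" "B y"] \<rho>(2) pos
    by (auto simp: U_def add.commute)
  have UA: "x \<in> {- ra<..<ra}" "y \<in> {- rb<..<rb}" if "(x, y) \<in> U" for x y
    using that by (auto simp: U_def)
  note gAB = AB[THEN g] and \<phi>AB = AB[THEN gI, THEN \<phi>]
  have dx: "dx w (x, y) = \<phi> (g (A x + B y)) * sqrt (a (A x))" if "(x, y) \<in> U" for x y
    unfolding dx_def w_def prod.case fst_conv snd_conv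
    by (rule DERIV_imp_deriv, rule separated_derivs(1))
      (use that in \<open>auto intro: gAB \<phi>AB A a AI apos UA\<close>)
  have dy: "dy w (x, y) = \<phi> (g (A x + B y)) * sqrt (b (B y))" if "(x, y) \<in> U" for x y
    unfolding dy_def w_def prod.case fst_conv snd_conv add.commute[of "A x"]
    by (rule DERIV_imp_deriv, rule separated_derivs(1))
      (use that in \<open>auto intro: gAB \<phi>AB B b AI apos UA\<close>)
  have dxx: "dx (dx w) (x, y) = \<phi> (g (A x + B y)) * \<phi>' (g (A x + B y)) * a (A x)
      + \<phi> (g (A x + B y)) * a' (A x) / 2" if xy: "(x, y) \<in> U" for x y
  proof -
    have "\<forall>\<^sub>F s in nhds x. s \<in> {- ra<..<ra}"
      using xy by (intro eventually_nhds_in_open) (auto simp: U_def)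
    then have "dx (dx w) (x, y) = deriv (\<lambda>x. \<phi> (g (A x + B y)) * sqrt (a (A x))) x"
      unfolding dx_def[of "dx w"] prod.case
      by (intro deriv_cong_ev) (use xy in \<open>auto elim!: eventually_mono intro!: dx simp: U_def\<close>)
    also have "\<dots> = \<phi> (g (A x + B y)) * \<phi>' (g (A x + B y)) * a (A x)
        + \<phi> (g (A x + B y)) * a' (A x) / 2"
      by (rule DERIV_imp_deriv, rule separated_derivs(2))
        (use xy in \<open>auto intro: gAB \<phi>AB A a AI apos UA\<close>)
    finally show ?thesis .
  qed
  have dyy: "dy (dy w) (x, y) = \<phi> (g (A x + B y)) * \<phi>' (g (A x + B y)) * b (B y)
      + \<phi> (g (A x + B y)) * b' (B y) / 2" if xy: "(x, y) \<in> U" for x y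
  proof -
    have "\<forall>\<^sub>F s in nhds y. s \<in> {- rb<..<rb}"
      using xy by (intro eventually_nhds_in_open) (auto simp: U_def)
    then have "dy (dy w) (x, y) = deriv (\<lambda>y. \<phi> (g (A x + B y)) * sqrt (b (B y))) y"
      unfolding dy_def[of "dy w"] prod.case
      by (intro deriv_cong_ev) (use xy in \<open>auto elim!: eventually_mono intro!: dy simp: U_def\<close>)
    also have "\<dots> = \<phi> (g (A x + B y)) * \<phi>' (g (A x + B y)) * b (B y)
        + \<phi> (g (A x + B y)) * b' (B y) / 2"
      unfolding add.commute[of "A x"]
      by (rule DERIV_imp_deriv, rule separated_derivs(2))
        (use xy in \<open>auto intro: gAB \<phi>AB B b AI apos UA\<close>)
    finally show ?thesis .
  qed
  have pde: "dx (dx w) (x, y) - e * dy (dy w) (x, y) = Q (w (x, y))" if xy: "(x, y) \<in> U" for x y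
  proof -
    define s where "s = A x + B y"
    have ee: "e * e = 1" using e by auto
    have half: "A x \<in> {- (r / 2)<..<r / 2}" "B y \<in> {- (r / 2)<..<r / 2}"
      using AR BR UA[OF xy] \<rho>(3) by blast+
    note split = additive_splitting[OF p p' \<theta> \<theta>' \<psi> \<psi>' \<psi>0 half]
    \<comment> \<open>The splitting subtracts \<open>p 0 = 1\<close>, which is the
      \<open>- 1\<close> in \<open>b\<close>; the constant \<open>C\<close> cancels because
      \<open>e * e = 1\<close>.\<close>
    have ab: "a (A x) - e * b (B y) = p s + \<theta> s * \<psi> (A x - B y)"
      using split(1) ee by (simp add: a_def b_def s_def p0 mult.assoc[symmetric])
    have ab': "a' (A x) - e * b' (B y) = 2 * (p' s + \<theta>' s * \<psi> (A x - B y))"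
      using split(2) ee by (simp add: a'_def b'_def s_def mult.assoc[symmetric])
    have "dx (dx w) (x, y) - e * dy (dy w) (x, y)
        = \<phi> (g s) * \<phi>' (g s) * (a (A x) - e * b (B y)) + \<phi> (g s) * (a' (A x) - e * b' (B y)) / 2"
      unfolding dxx[OF xy] dyy[OF xy] s_def by (simp add: field_simps)
    \<comment> \<open>By the definitions of \<open>p'\<close> and \<open>\<theta>'\<close>, half the
      sum of the derivatives of \<open>S\<close> is \<open>Q \<theta> - \<phi>' S\<close>. The terms
      \<open>\<phi> \<phi>' S\<close> cancel, and \<open>\<phi> \<theta> = 1\<close> leaves
      \<open>Q\<close>.\<close>
    also have "\<dots> = Q (g s)"
      unfolding ab ab' p'_def \<theta>'_def
      using nz[OF gI[OF AB(1)[OF xy]]] by (simp add: s_def \<theta>_def field_simps)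
    finally show ?thesis by (simp add: w_def s_def)
  qed
  have "separated_by f U w"
    unfolding separated_by_def
    by (rule exI[of _ "\<lambda>x. A x + f u0"], rule exI[of _ B]) (auto simp: w_def fg[OF AB(1)])
  moreover have "pde_solution \<delta> Q I U w"
    unfolding pde_solution_def e_def[symmetric]
    using \<open>smooth2_on U w\<close> pde gI[OF AB(1)] by (auto simp: w_def)
  moreover have "dx w z \<noteq> 0 \<and> dy w z \<noteq> 0" if "z \<in> U" for z
    using that nz[OF gI[OF AB(1)]] apos by (cases z) (force simp: dx dy)
  ultimately show ?thesis using U by blast
qed

section \<open>Reduction to the linear equations for \<phi> and Q\<close>

lemma admits_functional_separationI:
  fixes \<phi> \<phi>' q q' Q f :: "real \<Rightarrow> real" and k :: real and \<delta> :: complex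
  assumes \<delta>: "\<delta> \<in> {1, \<i>}" and I: "open I" "connected I" "I \<noteq> {}" and "smooth_on I Q"
    and Qq: "\<And>u. u \<in> I \<Longrightarrow> Q u = q u"
    and \<phi>: "\<And>u. u \<in> I \<Longrightarrow> (\<phi> has_real_derivative \<phi>' u) (at u)"
    and \<phi>': "\<And>u. u \<in> I \<Longrightarrow> (\<phi>' has_real_derivative k * \<phi> u) (at u)"
    and nz: "\<And>u. u \<in> I \<Longrightarrow> \<phi> u \<noteq> 0"
    and q: "\<And>u. u \<in> I \<Longrightarrow> (q has_real_derivative q' u) (at u)"
    and q': "\<And>u. u \<in> I \<Longrightarrow>
      (q' has_real_derivative \<phi>' u / \<phi> u * q' u + (3 * k - (\<phi>' u / \<phi> u)\<^sup>2) * q u) (at u)"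
    and f: "\<And>u. u \<in> I \<Longrightarrow> (f has_real_derivative 1 / \<phi> u) (at u)"
  shows "admits_functional_separation \<delta> Q I"
proof -
  \<comment> \<open>\<open>Q\<close> is known only on \<open>I\<close>, while the closed form
    \<open>q\<close> can be differentiated directly; openness of \<open>I\<close> transfers the
    derivative.\<close>
  have Q: "(Q has_real_derivative q' u) (at u)" if "u \<in> I" for u
    by (rule has_field_derivative_transform_within_open[OF q[OF that] \<open>open I\<close> that]) (simp add: Qq)
  have Q1: "(q' has_real_derivative \<phi>' u / \<phi> u * q' u + (3 * k - (\<phi>' u / \<phi> u)\<^sup>2) * Q u) (at u)"
    if "u \<in> I" for u
    using q'[OF that] Qq[OF that] by simp
  have n\<phi>: "ndiff_on n I \<phi>" for n
    by (rule ndiff_on_second_order(1)[where g = \<phi>' and k = k and c = 0]) (use \<phi> \<phi>' in auto)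
  have "ndiff_on n I f" for n
  proof (cases n)
    case (Suc n)
    show ?thesis unfolding Suc
      by (rule ndiff_on_Suc_real[OF f ndiff_on_divide[OF ndiff_on_const n\<phi> nz]])
  qed simp
  then have "smooth_on I f" by (rule smooth_onI[OF \<open>open I\<close>])
  have df: "deriv f u = 1 / \<phi> u" if "u \<in> I" for u
    by (rule DERIV_imp_deriv[OF f[OF that]])
  have coeff: "sep_coeff f u = \<phi>' u / \<phi> u" if u: "u \<in> I" for u
  proof -
    have "((\<lambda>u. 1 / \<phi> u) has_real_derivative - (\<phi>' u / (\<phi> u)\<^sup>2)) (at u)"
      by (rule derivative_eq_intros \<phi>[OF u] refl)+
        (use nz[OF u] in \<open>auto simp: field_simps power2_eq_square\<close>)
    then have "(deriv f has_real_derivative - (\<phi>' u / (\<phi> u)\<^sup>2)) (at u)"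
      by (rule has_field_derivative_transform_within_open[OF _ \<open>open I\<close> u]) (simp add: df)
    then show ?thesis
      using nz[OF u] by (simp add: sep_coeff_def df[OF u] DERIV_imp_deriv power2_eq_square)
  qed
  \<comment> \<open>The logarithmic derivative turns \<open>\<phi>'' = k \<phi>\<close> into the
    Riccati equation \<open>F' = k - F^2\<close>.\<close>
  have "(sep_coeff f has_real_derivative k - (sep_coeff f u)\<^sup>2) (at u)" if u: "u \<in> I" for u
  proof -
    have "((\<lambda>u. \<phi>' u / \<phi> u) has_real_derivative k - (sep_coeff f u)\<^sup>2) (at u)"
      by (rule derivative_eq_intros \<phi>[OF u] \<phi>'[OF u] nz[OF u] refl)+
        (use nz[OF u] in \<open>simp add: coeff[OF u] field_simps power2_eq_square\<close>)
    then show ?thesis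
      by (rule has_field_derivative_transform_within_open[OF _ \<open>open I\<close> u]) (simp add: coeff)
  qed
  then have "compatible \<delta> Q (sep_coeff f) I"
    by (intro compatible_if_ode[OF \<open>open I\<close> _ _ Q]) (use \<delta> Q1 coeff in auto)
  moreover have "smooth_invertible_on I f"
    unfolding smooth_invertible_on_def
    using \<open>smooth_on I f\<close> inj_on_if_deriv_nonzero[OF \<open>connected I\<close> f] nz df by auto
  moreover obtain u0 where "u0 \<in> I" using I by blast
  note separated_solution[OF \<delta> \<open>open I\<close> this \<phi> \<phi>' nz Q Q1 smooth_onD[OF \<open>open I\<close> \<open>smooth_on I Q\<close>] f]
  ultimately show ?thesis
    unfolding admits_functional_separation_def by blast
qed

text \<open>\<open>\<phi> \<phi>'\<close> always solves the linear equation for \<open>Q\<close>; the factor of \<open>b\<close> is a second solution,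
  found by reduction of order. It degenerates to \<open>0\<close> for \<open>\<phi> = exp (c u)\<close>, and \<open>\<phi> \<phi>'\<close> vanishes for
  \<open>\<phi> = 1\<close>, so these two cases need a separate treatment.\<close>

lemma admits_functional_separation_quadrature:
  fixes \<phi> \<phi>' Q L :: "real \<Rightarrow> real" and k a b :: real and \<delta> :: complex
  assumes "\<delta> \<in> {1, \<i>}" "open I" "connected I" "I \<noteq> {}" "smooth_on I Q"
    and Q: "\<And>u. u \<in> I \<Longrightarrow> Q u = a * (\<phi> u * \<phi>' u) + b * (\<phi> u + \<phi> u * \<phi>' u * L u)"
    and \<phi>: "\<And>u. u \<in> I \<Longrightarrow> (\<phi> has_real_derivative \<phi>' u) (at u)"
    and \<phi>': "\<And>u. u \<in> I \<Longrightarrow> (\<phi>' has_real_derivative k * \<phi> u) (at u)"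
    and nz: "\<And>u. u \<in> I \<Longrightarrow> \<phi> u \<noteq> 0"
    and L: "\<And>u. u \<in> I \<Longrightarrow> (L has_real_derivative 1 / \<phi> u) (at u)"
  shows "admits_functional_separation \<delta> Q I"
proof (rule admits_functional_separationI[OF assms(1-5) Q \<phi> \<phi>' nz _ _ L])
  fix u assume u: "u \<in> I"
  \<comment> \<open>This is the derivative of \<open>\<phi> \<phi>'\<close>. The factor of
    \<open>b\<close> contributes \<open>\<phi>'\<close> twice, the second time from
    \<open>\<phi> \<phi>' L' = \<phi>'\<close>.\<close>
  let ?D = "\<lambda>u. (\<phi>' u)\<^sup>2 + k * (\<phi> u)\<^sup>2"
  show "((\<lambda>u. a * (\<phi> u * \<phi>' u) + b * (\<phi> u + \<phi> u * \<phi>' u * L u))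
      has_real_derivative a * ?D u + b * (2 * \<phi>' u + ?D u * L u)) (at u)"
    by (rule derivative_eq_intros \<phi>[OF u] \<phi>'[OF u] L[OF u] refl)+
      (use nz[OF u] in \<open>simp add: field_simps power2_eq_square\<close>)
  show "((\<lambda>u. a * ?D u + b * (2 * \<phi>' u + ?D u * L u)) has_real_derivative
      \<phi>' u / \<phi> u * (a * ?D u + b * (2 * \<phi>' u + ?D u * L u))
      + (3 * k - (\<phi>' u / \<phi> u)\<^sup>2) * (a * (\<phi> u * \<phi>' u) + b * (\<phi> u + \<phi> u * \<phi>' u * L u))) (at u)"
    by (rule derivative_eq_intros \<phi>[OF u] \<phi>'[OF u] L[OF u] refl)+
      (use nz[OF u] in \<open>simp add: field_simps power2_eq_square\<close>)
qed

text \<open>With \<open>\<phi> = 1\<close> the coefficient \<open>F\<close> vanishes and the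
  equation for \<open>Q\<close> reads \<open>Q'' = 0\<close>; the separation is additive in
  \<open>w\<close> itself.\<close>

lemma admits_functional_separation_linear:
  assumes "\<delta> \<in> {1, \<i>}" "open I" "connected I" "I \<noteq> {}" "smooth_on I Q"
    and "\<forall>u\<in>I. Q u = c1 * u + c2"
  shows "admits_functional_separation \<delta> Q I"
  by (rule admits_functional_separationI[OF assms(1-5), where \<phi> = "\<lambda>u. 1" and \<phi>' = "\<lambda>u. 0"
        and k = 0 and f = "\<lambda>u. u" and q = "\<lambda>u. c1 * u + c2" and q' = "\<lambda>u. c1"])
    (use assms(6) in \<open>auto intro!: derivative_eq_intros\<close>)

text \<open>With \<open>\<phi> = exp (c u)\<close> one has \<open>F = c\<close>,
  \<open>k = c^2\<close> and \<open>Q'' = c Q' + 2 c^2 Q\<close>, whose characteristic roots are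
  \<open>2 c\<close> and \<open>- c\<close>. For \<open>c = 0\<close> the formula for
  \<open>f\<close> breaks down, but then \<open>Q\<close> is constant.\<close>

lemma admits_functional_separation_exp:
  fixes c c1 c2 :: real
  assumes "\<delta> \<in> {1, \<i>}" "open I" "connected I" "I \<noteq> {}" "smooth_on I Q"
    and Q: "\<forall>u\<in>I. Q u = c1 * exp (2 * c * u) + c2 * exp (- c * u)"
  shows "admits_functional_separation \<delta> Q I"
proof (cases "c = 0")
  case True
  then show ?thesis
    using Q admits_functional_separation_linear[OF assms(1-5), of 0 "c1 + c2"] by simp
next
  case False
  show ?thesis
  proof (rule admits_functional_separationI[OF assms(1-5), where \<phi> = "\<lambda>u. exp (c * u)"
        and \<phi>' = "\<lambda>u. c * exp (c * u)" and k = "c\<^sup>2" and f = "\<lambda>u. - exp (- c * u) / c"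
        and q = "\<lambda>u. c1 * exp (2 * c * u) + c2 * exp (- c * u)"
        and q' = "\<lambda>u. 2 * c * c1 * exp (2 * c * u) - c * c2 * exp (- c * u)"])
    fix u
    show "((\<lambda>u. 2 * c * c1 * exp (2 * c * u) - c * c2 * exp (- c * u)) has_real_derivative
        c * exp (c * u) / exp (c * u) * (2 * c * c1 * exp (2 * c * u) - c * c2 * exp (- c * u))
        + (3 * c\<^sup>2 - (c * exp (c * u) / exp (c * u))\<^sup>2)
          * (c1 * exp (2 * c * u) + c2 * exp (- c * u))) (at u)"
      by (rule derivative_eq_intros refl)+ (simp add: algebra_simps power2_eq_square)
    show "((\<lambda>u. - exp (- c * u) / c) has_real_derivative 1 / exp (c * u)) (at u)"
      using False by (auto intro!: derivative_eq_intros simp: exp_minus field_simps)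
  qed (use Q in \<open>auto intro!: derivative_eq_intros simp: power2_eq_square\<close>)
qed

section \<open>The eight listed forms of Q\<close>

theorem proposition2:
  fixes \<delta> :: complex and Q :: "real \<Rightarrow> real" and I :: "real set" and c c1 c2 :: real
  assumes "\<delta> \<in> {1, \<i>}"
    and "open I" and "connected I" and "I \<noteq> {}"
    and "smooth_on I Q"
    and "(\<forall>u\<in>I. Q u = c1 * u + c2)
       \<or> (\<forall>u\<in>I. Q u = c1 * exp (2 * u) + c2 * exp (- u))
       \<or> (\<forall>u\<in>I. Q u = c1 * exp (2 * c * u) + c2 * exp (- c * u))
       \<or> (\<forall>u\<in>I. u > 0 \<and> Q u = c1 * u + c2 * u * ln u)
       \<or> (\<forall>u\<in>I. Q u = c1 * sinh (2 * u)
              + c2 * (2 * cosh u + sinh (2 * u) * arctan (sinh u)))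
       \<or> (\<forall>u\<in>I. \<bar>sin u\<bar> < 1 \<and> Q u = c1 * sin (2 * u)
              + c2 / 4 * (sin (2 * u) * artanh (sin u) - 2 * cos u))
       \<or> (\<forall>u\<in>I. tan (u / 2) > 0 \<and> Q u = c1 * sin (2 * u)
              + c2 * (2 * sin u + sin (2 * u) * ln (tan (u / 2))))
       \<or> (\<forall>u\<in>I. tanh (u / 2) > 0 \<and> Q u = c1 * sinh (2 * u)
              + c2 * (2 * sinh u + sinh (2 * u) * ln (tanh (u / 2))))"
  shows "admits_functional_separation \<delta> Q I"
proof -
  note I = assms(1-5)
  from assms(6) consider
    (linear) "\<forall>u\<in>I. Q u = c1 * u + c2"
  | (exp_1) "\<forall>u\<in>I. Q u = c1 * exp (2 * u) + c2 * exp (- u)"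
  | (exp_c) "\<forall>u\<in>I. Q u = c1 * exp (2 * c * u) + c2 * exp (- c * u)"
  | (log) "\<forall>u\<in>I. u > 0 \<and> Q u = c1 * u + c2 * u * ln u"
  | (cosh) "\<forall>u\<in>I. Q u = c1 * sinh (2 * u) + c2 * (2 * cosh u + sinh (2 * u) * arctan (sinh u))"
  | (cos) "\<forall>u\<in>I. \<bar>sin u\<bar> < 1 \<and> Q u = c1 * sin (2 * u)
      + c2 / 4 * (sin (2 * u) * artanh (sin u) - 2 * cos u)"
  | (sin) "\<forall>u\<in>I. tan (u / 2) > 0 \<and> Q u = c1 * sin (2 * u)
      + c2 * (2 * sin u + sin (2 * u) * ln (tan (u / 2)))"
  | (sinh) "\<forall>u\<in>I. tanh (u / 2) > 0 \<and> Q u = c1 * sinh (2 * u)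
      + c2 * (2 * sinh u + sinh (2 * u) * ln (tanh (u / 2)))"
    by (elim disjE) blast+
  then show ?thesis
  proof cases
    case linear
    then show ?thesis by (rule admits_functional_separation_linear[OF I])
  next
    case exp_1
    then show ?thesis using admits_functional_separation_exp[OF I, of c1 1 c2] by simp
  next
    case exp_c
    then show ?thesis by (rule admits_functional_separation_exp[OF I])
  next
    case log
    \<comment> \<open>For \<open>\<phi> = u\<close> the second solution is
      \<open>u + u ln u\<close>; the shift to \<open>a = c1 - c2\<close> removes its extra
      \<open>u\<close>.\<close>
    show ?thesis
      by (rule admits_functional_separation_quadrature[OF I, where \<phi> = "\<lambda>u. u" and \<phi>' = "\<lambda>u. 1"
            and L = ln and k = 0 and a = "c1 - c2" and b = c2])
        (use log in \<open>auto intro!: derivative_eq_intros simp: algebra_simps\<close>)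
  next
    case cosh
    \<comment> \<open>Here \<open>\<phi> \<phi>' = sinh (2 u) / 2\<close>, whence the factors
      \<open>2\<close>; \<open>L\<close> is the Gudermannian function.\<close>
    show ?thesis
    proof (rule admits_functional_separation_quadrature[OF I, where \<phi> = cosh and \<phi>' = sinh
          and L = "\<lambda>u. arctan (sinh u)" and k = 1 and a = "2 * c1" and b = "2 * c2"])
      fix u assume "u \<in> I"
      then show "Q u = 2 * c1 * (cosh u * sinh u)
          + 2 * c2 * (cosh u + cosh u * sinh u * arctan (sinh u))"
        using cosh sinh_double[of u] by (simp add: algebra_simps)
      have sq: "1 + (sinh u)\<^sup>2 = (cosh u)\<^sup>2" by (simp add: cosh_square_eq)
      show "((\<lambda>u. arctan (sinh u)) has_real_derivative 1 / cosh u) (at u)"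
        by (rule derivative_eq_intros refl)+ (simp add: sq, simp add: field_simps power2_eq_square)
    qed (auto intro!: derivative_eq_intros)
  next
    case cos
    \<comment> \<open>Since \<open>\<phi> \<phi>' = - sin (2 u) / 2\<close>, both coefficients
      change sign. The condition on \<open>sin u\<close> gives the domain of \<open>artanh\<close>
      and also \<open>cos u \<noteq> 0\<close>.\<close>
    show ?thesis
    proof (rule admits_functional_separation_quadrature[OF I, where \<phi> = cos and \<phi>' = "\<lambda>u. - sin u"
          and L = "\<lambda>u. artanh (sin u)" and k = "- 1" and a = "- 2 * c1" and b = "- c2 / 2"])
      fix u assume u: "u \<in> I"
      then show "Q u = - 2 * c1 * (cos u * - sin u)
          + - c2 / 2 * (cos u + cos u * - sin u * artanh (sin u))"
        using cos sin_double[of u] by (simp add: algebra_simps)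
      have "\<bar>sin u\<bar> < 1" using cos u by blast
      then show nz: "cos u \<noteq> 0"
        using sin_squared_eq[of u] abs_square_less_1[of "sin u"] by auto
      show "((\<lambda>u. artanh (sin u)) has_real_derivative 1 / cos u) (at u)"
        by (rule DERIV_cong[OF DERIV_chain2[OF
              artanh_real_has_field_derivative[OF \<open>\<bar>sin u\<bar> < 1\<close>] DERIV_sin]])
          (use nz in \<open>simp add: cos_squared_eq[symmetric], simp add: field_simps power2_eq_square\<close>)
    qed (auto intro!: derivative_eq_intros)
  next
    case sin
    have half: "sin u = 2 * sin (u / 2) * cos (u / 2)" for u :: real
      using sin_double[of "u / 2"] by simp
    \<comment> \<open>Division by zero yields \<open>0\<close>, so positivity of the tangent
      excludes zeros of the cosine as well as of the sine.\<close>
    have nz: "sin (u / 2) \<noteq> 0" "cos (u / 2) \<noteq> 0" if "u \<in> I" for u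
      using sin that by (force simp: tan_def)+
    show ?thesis
    proof (rule admits_functional_separation_quadrature[OF I, where \<phi> = sin and \<phi>' = cos
          and L = "\<lambda>u. ln (tan (u / 2))" and k = "- 1" and a = "2 * c1" and b = "2 * c2"])
      fix u assume u: "u \<in> I"
      then show "Q u = 2 * c1 * (sin u * cos u) + 2 * c2 * (sin u + sin u * cos u * ln (tan (u / 2)))"
        using sin sin_double[of u] by (simp add: algebra_simps)
      show "sin u \<noteq> 0" using nz[OF u] by (simp add: half[of u])
      have "tan (u / 2) > 0" using sin u by blast
      then show "((\<lambda>u. ln (tan (u / 2))) has_real_derivative 1 / sin u) (at u)"
        using nz[OF u]
        by (auto intro!: derivative_eq_intros simp: half[of u] tan_def field_simps power2_eq_square)
    qed (auto intro!: derivative_eq_intros)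
  next
    case sinh
    have half: "sinh u = 2 * sinh (u / 2) * cosh (u / 2)" for u :: real
      using sinh_double[of "u / 2"] by simp
    have nz: "sinh (u / 2) \<noteq> 0" if "u \<in> I" for u
      using sinh that by (force simp: tanh_def)
    show ?thesis
    proof (rule admits_functional_separation_quadrature[OF I, where \<phi> = sinh and \<phi>' = cosh
          and L = "\<lambda>u. ln (tanh (u / 2))" and k = 1 and a = "2 * c1" and b = "2 * c2"])
      fix u assume u: "u \<in> I"
      then show "Q u = 2 * c1 * (sinh u * cosh u)
          + 2 * c2 * (sinh u + sinh u * cosh u * ln (tanh (u / 2)))"
        using sinh sinh_double[of u] by (simp add: algebra_simps)
      show "sinh u \<noteq> 0" using nz[OF u] by (simp add: half[of u])
      have pos: "tanh (u / 2) > 0" using sinh u by blast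
      have "((\<lambda>u. ln (tanh (u / 2))) has_real_derivative
          1 / tanh (u / 2) * ((1 - (tanh (u / 2))\<^sup>2) * (1 / 2))) (at u)"
        using pos by (auto intro!: derivative_eq_intros)
      moreover have "1 - (tanh (u / 2))\<^sup>2 = ((cosh (u / 2))\<^sup>2 - (sinh (u / 2))\<^sup>2) / (cosh (u / 2))\<^sup>2"
        by (simp add: diff_divide_distrib tanh_def power_divide)
      then have sech: "1 - (tanh (u / 2))\<^sup>2 = 1 / (cosh (u / 2))\<^sup>2"
        by (simp add: cosh_square_eq)
      \<comment> \<open>The left side is \<open>1 / (2 sinh (u / 2) cosh (u / 2))\<close>, and the
        double angle formula applies.\<close>
      have "1 / tanh (u / 2) * ((1 - (tanh (u / 2))\<^sup>2) * (1 / 2)) = 1 / sinh u"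
        unfolding sech using nz[OF u] by (simp add: half[of u] tanh_def power2_eq_square)
      ultimately show "((\<lambda>u. ln (tanh (u / 2))) has_real_derivative 1 / sinh u) (at u)"
        by metis
    qed (auto intro!: derivative_eq_intros)
  qed
qed

end
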